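(* Let $d,f$ be positive integers and $G$ a graph on $n$ vertices of degeneracy $d$. Let $\mathcal{F}$ be a $4d$-neighborhood-witnessing layered family of $G$ with thickness at most $\lceil\log n\rceil$, and let $A,B\subseteq V(G)$. Then at least one of the following exists: (1) an $A$--$B$ separator $S\subseteq V(G)$ in $G$ with $\mathrm{fcov}_{\mathcal{F}}(S)\le 8\log^2 2n\cdot f$; (2) an induced subgraph $H$ of $G$ of maximum degree at most $12\log^2 2n+4d$ such that every $A_H$--$B_H$ separator $S$ in $H$ satisfies $\mathrm{cov}_{\mathcal{F}}(S)\ge\frac f6$, where $A_H:=A\cap V(H)$ and $B_H:=B\cap V(H)$.
   Context: Logarithms are base 2. Layered family: given an ordered partition $\Pi=(L_1,\dots,L_m)$ of $V(G)$, the layer digraph has an arc $(u,v)$ iff $uv\in E(G)$, $u\in L_i$, $v\in L_j$, $j<i$. $v$ is a descendant of $u$ if there is a directed path from $u$ to $v$ (including $v=u$). For each vertex $u$ with no in-arcs, the set of $u$ and all its descendants belongs to $\mathcal{F}$. Thickness: smallest $k$ such that every member meets at most $k$ parts of $\Pi$. $\mathcal{F}$ is $4d$-neighborhood-witnessing if for every vertex $v$ and every $F\in\mathcal{F}$ containing $v$, $|N[v]\setminus F|\le 4d$. An $A$--$B$ separator meets every path from $A$ to $B$. $\mathrm{fcov}_{\mathcal{F}}(S)$ is the minimum of $\sum_F y_F$ over nonnegative $\{y_F\}$ with $\sum_{F\ni v}y_F\ge1$ for all $v\in S$; $\mathrm{cov}_{\mathcal{F}}(S)$ is the minimum number of members of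 $\mathcal{F}$ whose union contains $S$. *)

theory Defs
  imports Complex_Main "HOL-Library.Disjoint_Sets" "Graph_Theory.Digraph_Component"
begin

text \<open>
  A finite simple graph is a symmetric, loop-free digraph without parallel arcs
  (locale \<^locale>\<open>graph\<close>): the edge \<open>uv\<close> is the pair of arcs \<open>(u,v)\<close>, \<open>(v,u)\<close>. Hence the
  degree of a vertex is its out-degree.
\<close>

text \<open>The inserted \<open>0\<close> only matters for the null graph.\<close>
definition max_degree :: "('a,'b) pre_digraph \<Rightarrow> nat" where
  "max_degree G = Max (insert 0 (out_degree G ` verts G))"

definition degeneracy :: "('a,'b) pre_digraph \<Rightarrow> nat" where
  "degeneracy G = (LEAST k. \<forall>H. subgraph H G \<and> graph H \<and> verts H \<noteq> {} \<longrightarrow>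
     (\<exists>v\<in>verts H. out_degree H v \<le> k))"

definition closed_nbhd :: "('a,'b) pre_digraph \<Rightarrow> 'a \<Rightarrow> 'a set" where
  "closed_nbhd G v = insert v {u. v \<rightarrow>\<^bsub>G\<^esub> u}"

text \<open>
  Paths may consist of a single vertex, so a separator contains \<open>A \<inter> B\<close> (for
  \<open>A, B\<close> sets of vertices); it may also contain other vertices of \<open>A\<close> and \<open>B\<close>.
\<close>
definition separator :: "('a,'b) pre_digraph \<Rightarrow> 'a set \<Rightarrow> 'a set \<Rightarrow> 'a set \<Rightarrow> bool" where
  "separator G A B S \<longleftrightarrow> S \<subseteq> verts G \<and>
     (\<forall>a\<in>A. \<forall>b\<in>B. \<forall>p. pre_digraph.apath G a p b \<longrightarrow>
        set (pre_digraph.awalk_verts G a p) \<inter> S \<noteq> {})"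

definition ordered_partition :: "'a set \<Rightarrow> 'a set list \<Rightarrow> bool" where
  "ordered_partition V Ls \<longleftrightarrow> distinct Ls \<and> partition_on V (set Ls)"

definition layer_digraph :: "('a,'b) pre_digraph \<Rightarrow> 'a set list \<Rightarrow> ('a,'b) pre_digraph" where
  "layer_digraph G Ls = G\<lparr>arcs := {e \<in> arcs G. \<exists>i j. j < i \<and> i < length Ls \<and>
     tail G e \<in> Ls ! i \<and> head G e \<in> Ls ! j}\<rparr>"

definition descendants :: "('a,'b) pre_digraph \<Rightarrow> 'a set list \<Rightarrow> 'a \<Rightarrow> 'a set" where
  "descendants G Ls u = {v. u \<rightarrow>\<^sup>*\<^bsub>layer_digraph G Ls\<^esub> v}"

definition layered_family :: "('a,'b) pre_digraph \<Rightarrow> 'a set list \<Rightarrow> 'a set set \<Rightarrow> bool" where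
  "layered_family G Ls \<F> \<longleftrightarrow> ordered_partition (verts G) Ls \<and>
     \<F> = descendants G Ls ` {u \<in> verts G. in_arcs (layer_digraph G Ls) u = {}}"

definition thickness :: "'a set list \<Rightarrow> 'a set set \<Rightarrow> nat" where
  "thickness Ls \<F> = (LEAST k. \<forall>F\<in>\<F>. card {L \<in> set Ls. F \<inter> L \<noteq> {}} \<le> k)"

definition neighborhood_witnessing :: "('a,'b) pre_digraph \<Rightarrow> nat \<Rightarrow> 'a set set \<Rightarrow> bool" where
  "neighborhood_witnessing G k \<F> \<longleftrightarrow>
     (\<forall>v\<in>verts G. \<forall>F\<in>\<F>. v \<in> F \<longrightarrow> card (closed_nbhd G v - F) \<le> k)"

definition cov :: "'a set set \<Rightarrow> 'a set \<Rightarrow> nat" where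
  "cov \<F> S = (LEAST k. \<exists>\<C>\<subseteq>\<F>. finite \<C> \<and> S \<subseteq> \<Union>\<C> \<and> card \<C> = k)"

text \<open>
  For finite \<open>\<F>\<close> covering \<open>S\<close> the infimum is the optimum of a feasible, bounded finite
  linear program, hence a minimum. A layered family covers every set of vertices, see
  \<open>layered_family_covers\<close> below, so neither \<open>cov\<close> nor \<open>fcov\<close> is ever taken over an
  empty set of covers.
\<close>
definition fcov :: "'a set set \<Rightarrow> 'a set \<Rightarrow> real" where
  "fcov \<F> S = Inf {(\<Sum>F\<in>\<F>. y F) | y.
     (\<forall>F\<in>\<F>. 0 \<le> y F) \<and> (\<forall>v\<in>S. 1 \<le> (\<Sum>F | F \<in> \<F> \<and> v \<in> F. y F))}"

lemma layered_family_finite: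
  assumes "graph G" "layered_family G Ls \<F>"
  shows "finite \<F>"
proof -
  interpret graph G by fact
  show ?thesis using assms(2) by (simp add: layered_family_def)
qed

lemma layered_family_covers:
  assumes "graph G" "layered_family G Ls \<F>"
  shows "\<Union>\<F> = verts G"
proof -
  interpret graph G by fact
  let ?D = "layer_digraph G Ls"
  interpret D: wf_digraph ?D
    by unfold_locales (auto simp: layer_digraph_def)
  have op: "\<Union>(set Ls) = verts G" and dj: "disjoint (set Ls)" and di: "distinct Ls"
    using assms(2) by (auto simp: layered_family_def ordered_partition_def partition_on_def)
  have F: "\<F> = descendants G Ls ` {u \<in> verts G. in_arcs ?D u = {}}"
    using assms(2) by (simp add: layered_family_def)
  have vD: "verts ?D = verts G" by (simp add: layer_digraph_def)
  have uniq: "i = j" if "i < length Ls" "j < length Ls" "x \<in> Ls ! i" "x \<in> Ls ! j" for i j x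
    using dj di that by (metis disjoint_iff disjointD nth_eq_iff_index_eq nth_mem)
  have reach: "\<exists>u\<in>verts G. in_arcs ?D u = {} \<and> u \<rightarrow>\<^sup>*\<^bsub>?D\<^esub> v"
    if "i < length Ls" "v \<in> Ls ! i" for i v
    using that
  proof (induction "length Ls - i" arbitrary: i v rule: less_induct)
    case less
    have v: "v \<in> verts G" using less.prems op by (metis UnionI nth_mem)
    show ?case
    proof (cases "in_arcs ?D v = {}")
      case True
      then show ?thesis using v vD by auto
    next
      case False
      then obtain e where e: "e \<in> arcs ?D" "head ?D e = v" unfolding in_arcs_def by blast
      then obtain k j where k: "j < k" "k < length Ls" "tail G e \<in> Ls ! k" "v \<in> Ls ! j"
        by (auto simp: layer_digraph_def)
      have "j = i" using uniq[of j i v] k less.prems by simp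
      then have "length Ls - k < length Ls - i" using k by simp
      from less.hyps[OF this k(2,3)]
      obtain u where u: "u \<in> verts G" "in_arcs ?D u = {}" "u \<rightarrow>\<^sup>*\<^bsub>?D\<^esub> tail G e" by blast
      have "arc_to_ends ?D e = (tail G e, v)"
        using e by (simp add: arc_to_ends_def layer_digraph_def)
      then have "tail G e \<rightarrow>\<^bsub>?D\<^esub> v" using e(1) by (rule D.dominatesI)
      then show ?thesis using u D.reachable_adj_trans by blast
    qed
  qed
  show ?thesis
  proof
    show "\<Union>\<F> \<subseteq> verts G"
      using D.reachable_in_verts(2) vD by (auto simp: F descendants_def)
    show "verts G \<subseteq> \<Union>\<F>"
    proof
      fix v assume "v \<in> verts G"
      then obtain i where "i < length Ls" "v \<in> Ls ! i"
        using op by (metis UnionE in_set_conv_nth)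
      from reach[OF this] show "v \<in> \<Union>\<F>" by (auto simp: F descendants_def)
    qed
  qed
qed

end

theory Submission
  imports Defs
begin

text \<open>
  Multiplicative weights replace both linear programming duality and random sampling. Walks from
  \<open>A\<close> to \<open>B\<close> are picked one after another; a member of \<open>\<F>\<close> hit \<open>k\<close> times so far has weight \<open>2 ^ k\<close>.
  As long as some walk meets members of at most a \<open>1 / f\<close> fraction of the total weight, picking it
  multiplies the total weight by at most \<open>1 + 1 / f\<close>; so after about \<open>f log 2n\<close> picks no member is
  hit more than \<open>6 log 2n\<close> times, and a cover of a separator of the union of the walks has at least
  \<open>f / 6\<close> members. A walk can be shortcut through the root of a member: since members are closed
  under descendants, the shortcut meets no new members, so each walk may be assumed to have at most
  \<open>2 log 2n\<close> vertices in each member. This bounds the degrees.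

  If no light walk exists, the normalised weights \<open>y\<close> have total \<open>f\<close>, and the vertex lengths
  \<open>x v = (\<Sum>F\<ni>v. y F)\<close> make every walk from \<open>A\<close> to \<open>B\<close> have length at least \<open>1\<close>. The separator
  consists of the vertices at distance \<open>r\<close> from \<open>A\<close>. Lengths do not decrease towards descendants,
  hence if such a vertex \<open>v\<close> lies in \<open>F\<close>, the root of \<open>F\<close> is at distance \<open>r\<close> up to \<open>x v log 2n\<close>, and
  the separator is fractionally covered by \<open>y F\<close> times roughly \<open>log 2n\<close> over the deviation of the
  root of \<open>F\<close> from \<open>r\<close>. Averaging over \<open>r\<close> costs another logarithm.
\<close>

section \<open>Walks\<close>

text \<open>Vertex lists over a bare relation may repeat vertices, so detours can be spliced in
  freely; \<open>apath_imp_walk\<close> and \<open>walk_imp_apath\<close> connect them to simple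
  paths.\<close>

definition walk :: "('a \<Rightarrow> 'a \<Rightarrow> bool) \<Rightarrow> 'a \<Rightarrow> 'a list \<Rightarrow> 'a \<Rightarrow> bool" where
  "walk E a xs b \<longleftrightarrow> xs \<noteq> [] \<and> hd xs = a \<and> last xs = b \<and> successively E xs"

lemma walk_Nil [simp]: "\<not> walk E a [] b"
  by (simp add: walk_def)

lemma walk_singleton [simp]: "walk E a [a] a"
  by (simp add: walk_def)

lemma walk_Cons: "walk E a (x # xs) b \<longleftrightarrow> a = x \<and> (xs = [] \<and> b = a \<or> E a (hd xs) \<and> walk E (hd xs) xs b)"
  by (cases xs) (auto simp: walk_def)

lemma walk_join:
  assumes "walk E a xs b" "walk E b ys c"
  shows "walk E a (xs @ tl ys) c"
proof -
  obtain y zs where ys: "ys = y # zs" using assms(2) by (cases ys) (auto simp: walk_def)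
  then show ?thesis
    using assms by (cases zs) (auto simp: walk_def successively_append_iff)
qed

lemma walk_snoc:
  assumes "walk E a xs b" "E b c"
  shows "walk E a (xs @ [c]) c"
  using assms by (auto simp: walk_def successively_append_iff)

lemma walk_rev:
  assumes "walk E a xs b" "\<And>u v. E u v \<Longrightarrow> E v u"
  shows "walk E b (rev xs) a"
  using assms(1) assms(2) by (auto simp: walk_def hd_rev last_rev intro: successively_mono)

lemma walk_prefix:
  assumes "walk E a (xs @ v # ys) b"
  shows "walk E a (xs @ [v]) v"
  using assms by (auto simp: walk_def successively_append_iff hd_append)

lemma walk_suffix:
  assumes "walk E a (xs @ v # ys) b"
  shows "walk E v (v # ys) b"
  using assms by (auto simp: walk_def successively_append_iff)

lemma walk_mono:
  assumes "walk E a xs b" "\<And>u v. u \<in> set xs \<Longrightarrow> v \<in> set xs \<Longrightarrow> E u v \<Longrightarrow> E' u v"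
  shows "walk E' a xs b"
  using assms by (auto simp: walk_def intro: successively_mono)

lemma walk_set_subset:
  assumes "walk E a xs b" "a \<in> V" "\<And>u v. E u v \<Longrightarrow> v \<in> V"
  shows "set xs \<subseteq> V"
  using assms(1,2)
proof (induction xs arbitrary: a)
  case (Cons x xs)
  then show ?case using assms(3) by (auto simp: walk_Cons)
qed auto

section \<open>Potentials along walks and averaging over levels\<close>

lemma walk_lipschitz:
  fixes p :: "'a \<Rightarrow> real"
  assumes "walk E a xs b"
    and "\<And>u v. E u v \<Longrightarrow> u \<in> set xs \<Longrightarrow> v \<in> set xs \<Longrightarrow> \<bar>p u - p v\<bar> \<le> c"
  shows "\<bar>p a - p b\<bar> \<le> (real (length xs) - 1) * c"
  using assms
proof (induction xs arbitrary: a)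
  case (Cons x xs)
  show ?case
  proof (cases "xs = []")
    case False
    then have e: "a = x" "E a (hd xs)" and w: "walk E (hd xs) xs b"
      using Cons.prems(1) by (auto simp: walk_Cons)
    have "\<bar>p (hd xs) - p b\<bar> \<le> (real (length xs) - 1) * c"
      using Cons.IH[OF w] Cons.prems(2) by simp
    moreover have "\<bar>p a - p (hd xs)\<bar> \<le> c"
      using e Cons.prems(2) False by simp
    ultimately show ?thesis by (simp add: algebra_simps)
  qed (use Cons.prems in \<open>auto simp: walk_Cons\<close>)
qed (auto simp: walk_def)

text \<open>Take the first vertex \<open>v\<close> with \<open>r \<le> p v\<close>. A predecessor
  \<open>u\<close> has \<open>p u < r\<close>, so \<open>p v - x v \<le> p u < r\<close>; the
  hypothesis on \<open>a\<close> handles the case that \<open>v\<close> is the start.\<close>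

lemma walk_crosses_threshold:
  fixes p x :: "'a \<Rightarrow> real"
  assumes "walk E a xs b" "\<And>u v. E u v \<Longrightarrow> p v \<le> p u + x v"
    and "p a - x a < r" "r \<le> p b"
  shows "\<exists>v\<in>set xs. p v - x v < r \<and> r \<le> p v"
  using assms(1,3)
proof (induction xs arbitrary: a)
  case (Cons y xs)
  show ?case
  proof (cases "r \<le> p a")
    case True
    then show ?thesis using Cons.prems by (auto simp: walk_Cons)
  next
    case False
    then have e: "E a (hd xs)" and w: "walk E (hd xs) xs b"
      using Cons.prems(1) assms(4) by (auto simp: walk_Cons)
    have "p (hd xs) - x (hd xs) < r" using assms(2)[OF e] False by linarith
    then show ?thesis using Cons.IH[OF w] by auto
  qed
qed (auto simp: walk_def)

text \<open>Take the infimum of the \<open>x\<close>-lengths of walks from \<open>A\<close> to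
  \<open>v\<close>, both ends counted, capped at \<open>R\<close>. The cap gives unreachable
  vertices a value and bounds the range of levels to average over.\<close>

lemma truncated_distance_exists:
  fixes x :: "'a \<Rightarrow> real"
  assumes "\<And>v. 0 \<le> x v" "0 \<le> R"
    and long: "\<And>a b xs. a \<in> A \<Longrightarrow> b \<in> B \<Longrightarrow> walk E a xs b \<Longrightarrow> R \<le> (\<Sum>v\<leftarrow>xs. x v)"
  obtains p :: "'a \<Rightarrow> real" where "\<And>v. 0 \<le> p v" "\<And>v. p v \<le> R"
    "\<And>u v. E u v \<Longrightarrow> p v \<le> p u + x v" "\<And>a. a \<in> A \<Longrightarrow> p a \<le> x a" "\<And>b. b \<in> B \<Longrightarrow> R \<le> p b"
proof -
  define W where "W v = insert R {\<Sum>u\<leftarrow>xs. x u | xs. \<exists>a\<in>A. walk E a xs v}" for v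
  have nonneg: "0 \<le> t" if "t \<in> W v" for t v
    using that assms(1,2) by (auto simp: W_def intro!: sum_list_nonneg)
  have bdd: "bdd_below (W v)" for v
    using nonneg by (rule bdd_belowI)
  have ne: "W v \<noteq> {}" for v by (simp add: W_def)
  show ?thesis
  proof
    show "0 \<le> Inf (W v)" for v
      using ne nonneg by (rule cInf_greatest)
    show "Inf (W v) \<le> R" for v
      by (rule cInf_lower[OF _ bdd]) (simp add: W_def)
    show "Inf (W v) \<le> Inf (W u) + x v" if e: "E u v" for u v
    proof -
      have "Inf (W v) - x v \<le> t" if "t \<in> W u" for t
      proof (cases "t = R")
        case True
        have "Inf (W v) \<le> R" by (rule cInf_lower[OF _ bdd]) (simp add: W_def)
        then show ?thesis using True assms(1)[of v] by linarith
      next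
        case False
        then obtain xs a where "t = (\<Sum>u\<leftarrow>xs. x u)" "a \<in> A" "walk E a xs u"
          using \<open>t \<in> W u\<close> by (auto simp: W_def)
        then have "t + x v \<in> W v"
          using walk_snoc[of E a xs u v] e by (force simp: W_def)
        from cInf_lower[OF this bdd] show ?thesis by linarith
      qed
      then have "Inf (W v) - x v \<le> Inf (W u)" by (intro cInf_greatest ne)
      then show ?thesis by linarith
    qed
    show "Inf (W a) \<le> x a" if "a \<in> A" for a
    proof (rule cInf_lower[OF _ bdd])
      show "x a \<in> W a"
        unfolding W_def using that by (auto intro!: exI[of _ "[a]"] bexI[of _ a])
    qed
    show "R \<le> Inf (W b)" if "b \<in> B" for b
      using ne by (rule cInf_greatest) (use that long in \<open>auto simp: W_def\<close>)
  qed
qed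

lemma sum_set_le_sum_list:
  fixes g :: "'a \<Rightarrow> real"
  assumes "\<And>v. 0 \<le> g v"
  shows "(\<Sum>v\<in>set xs. g v) \<le> (\<Sum>v\<leftarrow>xs. g v)"
  using assms by (induction xs) (auto simp: sum.insert_if add_increasing)

text \<open>
  The kernel is a smooth substitute for \<open>min (1 / \<bar>r - c i\<bar>) (1 / a)\<close>; it has the antiderivative
  \<open>arsinh\<close>, so averaging over \<open>r\<close> reduces to the mean value theorem.
\<close>

lemma exists_small_kernel_sum:
  fixes y c :: "'i \<Rightarrow> real"
  assumes "finite I" "\<And>i. i \<in> I \<Longrightarrow> 0 \<le> y i" "\<And>i. i \<in> I \<Longrightarrow> 0 \<le> c i \<and> c i \<le> 1 / 2" "0 < a"
  shows "\<exists>r. 0 < r \<and> r < 1 / 2 \<and>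
    (\<Sum>i\<in>I. y i / sqrt ((r - c i)\<^sup>2 + a\<^sup>2)) \<le> 4 * arsinh (1 / (2 * a)) * (\<Sum>i\<in>I. y i)"
proof -
  define h where "h r = (\<Sum>i\<in>I. y i * arsinh ((r - c i) / a))" for r
  define h' where "h' r = (\<Sum>i\<in>I. y i / sqrt ((r - c i)\<^sup>2 + a\<^sup>2))" for r
  have "(h has_real_derivative h' r) (at r)" for r
    unfolding h_def h'_def
  proof (rule DERIV_sum)
    fix i
    have "a * sqrt (((r - c i) / a)\<^sup>2 + 1) = sqrt (a\<^sup>2 * (((r - c i) / a)\<^sup>2 + 1))"
      using assms(4) by (simp add: real_sqrt_mult)
    also have "a\<^sup>2 * (((r - c i) / a)\<^sup>2 + 1) = (r - c i)\<^sup>2 + a\<^sup>2"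
      using assms(4) by (simp add: field_simps)
    finally have eq: "a * sqrt (((r - c i) / a)\<^sup>2 + 1) = sqrt ((r - c i)\<^sup>2 + a\<^sup>2)" .
    have "((\<lambda>r. y i * arsinh ((r - c i) / a)) has_real_derivative
        y i * (1 / sqrt (((r - c i) / a)\<^sup>2 + 1) * (1 / a))) (at r)"
    proof (rule DERIV_cmult[OF DERIV_chain2[OF arsinh_real_has_field_derivative]])
      show "((\<lambda>r. (r - c i) / a) has_real_derivative 1 / a) (at r)"
        using assms(4) by (auto intro!: derivative_eq_intros)
    qed
    also have "y i * (1 / sqrt (((r - c i) / a)\<^sup>2 + 1) * (1 / a)) = y i / sqrt ((r - c i)\<^sup>2 + a\<^sup>2)"
      unfolding eq[symmetric] by simp
    finally show "((\<lambda>r. y i * arsinh ((r - c i) / a)) has_real_derivative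
        y i / sqrt ((r - c i)\<^sup>2 + a\<^sup>2)) (at r)" .
  qed
  then obtain r where r: "0 < r" "r < 1 / 2" "h (1 / 2) - h 0 = (1 / 2 - 0) * h' r"
    using MVT2[of 0 "1/2" h h'] by auto
  have mono: "arsinh s \<le> arsinh t" if "s \<le> t" for s t :: real
    using that arsinh_less_iff_real[of t s] by linarith
  \<comment> \<open>\<open>arsinh\<close> is odd, so each difference splits into two terms with
    arguments at most \<open>1 / (2 * a)\<close>. The interval length 1/2 in the mean value theorem
    then doubles the factor 2.\<close>
  have "h (1 / 2) - h 0 = (\<Sum>i\<in>I. y i * (arsinh ((1 / 2 - c i) / a) + arsinh (c i / a)))"
    by (simp add: h_def sum_subtractf[symmetric] algebra_simps)
  also have "\<dots> \<le> (\<Sum>i\<in>I. y i * (2 * arsinh (1 / (2 * a))))"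
  proof (intro sum_mono mult_left_mono)
    fix i assume i: "i \<in> I"
    have "(1 / 2 - c i) / a \<le> 1 / (2 * a)" "c i / a \<le> 1 / (2 * a)"
      using assms(3)[OF i] assms(4) by (auto simp: field_simps)
    then show "arsinh ((1 / 2 - c i) / a) + arsinh (c i / a) \<le> 2 * arsinh (1 / (2 * a))"
      using mono by (smt (verit))
  qed (use assms in auto)
  also have "\<dots> = 2 * arsinh (1 / (2 * a)) * (\<Sum>i\<in>I. y i)"
    by (subst sum_distrib_right[symmetric]) simp
  finally show ?thesis using r by (auto simp: h'_def)
qed

section \<open>Families with short connections to a root\<close>

text \<open>
  The only consequences of being a layered family that matter: every member has a root from which
  each of its vertices is reached by a short walk, and a member meeting that walk contains its
  endpoint.
\<close>

locale rooted_family =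
  fixes V :: "'a set" and E :: "'a \<Rightarrow> 'a \<Rightarrow> bool" and \<F> :: "'a set set"
    and root :: "'a set \<Rightarrow> 'a" and M :: real
  assumes finite_V: "finite V"
    and E_sym: "E u v \<Longrightarrow> E v u"
    and E_in_V: "E u v \<Longrightarrow> v \<in> V"
    and finite_\<F>: "finite \<F>"
    and M_ge_1: "1 \<le> M"
    and root_walk: "\<lbrakk>F \<in> \<F>; v \<in> F\<rbrakk> \<Longrightarrow> \<exists>zs. walk E (root F) zs v \<and> real (length zs) \<le> M \<and>
      (\<forall>F'\<in>\<F>. F' \<inter> set zs \<noteq> {} \<longrightarrow> v \<in> F')"
begin

lemma exists_short_walk:
  assumes "walk E a xs b"
  shows "\<exists>ys. walk E a ys b \<and> (\<forall>F\<in>\<F>. F \<inter> set ys \<noteq> {} \<longrightarrow> F \<inter> set xs \<noteq> {}) \<and>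
    (\<forall>F\<in>\<F>. real (card (F \<inter> set ys)) \<le> 2 * M - 1)"
proof -
  \<comment> \<open>A shortest walk meeting no new members cannot linger in any \<open>F\<close>,
    since a detour through the root would be shorter.\<close>
  define Q where "Q ys \<longleftrightarrow> walk E a ys b \<and> (\<forall>F\<in>\<F>. F \<inter> set ys \<noteq> {} \<longrightarrow> F \<inter> set xs \<noteq> {})" for ys
  have "Q xs" using assms by (simp add: Q_def)
  then obtain ys where ys: "Q ys" and min: "\<And>zs. Q zs \<Longrightarrow> length ys \<le> length zs"
    using ex_has_least_nat[of Q xs length] by blast
  have "real (card (F \<inter> set ys)) \<le> 2 * M - 1" if F: "F \<in> \<F>" for F
  proof (cases "F \<inter> set ys = {}")
    case True
    then show ?thesis using M_ge_1 by simp
  next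
    case False
    then obtain as v bs where s1: "ys = as @ v # bs" "v \<in> F" "\<forall>u\<in>set as. u \<notin> F"
      using split_list_first_prop[of ys "\<lambda>u. u \<in> F"] by blast
    then obtain cs w ds where s2: "v # bs = cs @ w # ds" "w \<in> F" "\<forall>u\<in>set ds. u \<notin> F"
      using split_list_last_prop[of "v # bs" "\<lambda>u. u \<in> F"] by auto
    have yw: "walk E a ys b" using ys by (simp add: Q_def)
    have w1: "walk E a (as @ [v]) v" using walk_prefix yw s1(1) by metis
    have w4: "walk E w (w # ds) b"
      using walk_suffix[of E a "as @ cs" w ds b] yw s1(1) s2(1) by simp
    obtain zv where zv: "walk E (root F) zv v" "real (length zv) \<le> M"
      "\<forall>F'\<in>\<F>. F' \<inter> set zv \<noteq> {} \<longrightarrow> v \<in> F'"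
      using root_walk[OF F s1(2)] by blast
    obtain zw where zw: "walk E (root F) zw w" "real (length zw) \<le> M"
      "\<forall>F'\<in>\<F>. F' \<inter> set zw \<noteq> {} \<longrightarrow> w \<in> F'"
      using root_walk[OF F s2(2)] by blast
    \<comment> \<open>Replace the part of \<open>ys\<close> between its first and last vertex in \<open>F\<close> by a detour via the root.\<close>
    let ?N = "((as @ [v]) @ tl (rev zv)) @ tl (zw @ tl (w # ds))"
    have "walk E a ?N b"
      by (intro walk_join[OF walk_join[OF w1 walk_rev[OF zv(1) E_sym]]] walk_join[OF zw(1) w4])
    \<comment> \<open>New vertices of \<open>?N\<close> lie on \<open>zv\<close> or
      \<open>zw\<close>, and members meeting these contain \<open>v\<close> or \<open>w\<close>,
      which are already on \<open>ys\<close>.\<close>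
    moreover have "\<forall>F'\<in>\<F>. F' \<inter> set ?N \<noteq> {} \<longrightarrow> F' \<inter> set xs \<noteq> {}"
    proof (intro ballI impI)
      fix F' assume F': "F' \<in> \<F>" "F' \<inter> set ?N \<noteq> {}"
      have tl: "set (tl l) \<subseteq> set l" for l :: "'a list" by (cases l) auto
      have "set (v # bs) = set (cs @ w # ds)" using s2(1) by metis
      then have "set ?N \<subseteq> set ys \<union> set zv \<union> set zw"
        using s1(1) tl[of "rev zv"] tl[of "zw @ ds"] by auto
      moreover have "v \<in> set ys" "w \<in> set ys" using s1(1) \<open>set (v # bs) = set (cs @ w # ds)\<close> by auto
      ultimately have "F' \<inter> set ys \<noteq> {}" using F' zv(3) zw(3) by blast
      then show "F' \<inter> set xs \<noteq> {}" using ys F' by (simp add: Q_def)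
    qed
    ultimately have le: "length ys \<le> length ?N" by (intro min) (simp add: Q_def)
    have "zv \<noteq> []" "zw \<noteq> []" using zv zw by (auto simp: walk_def)
    \<comment> \<open>The joins count \<open>v\<close>, the root and \<open>w\<close> once each, so
      the detour from \<open>v\<close> to \<open>w\<close> has
      \<open>length zv + length zw - 1\<close> vertices; hence the bound
      \<open>2 * M - 1\<close>.\<close>
    then have "real (length ?N) = real (length as) + length zv + length zw - 1 + length ds"
      by (cases zv; cases zw) auto
    moreover have "length ys = length as + length (cs @ [w]) + length ds"
      using s1(1) s2(1) by simp
    ultimately have "real (length (cs @ [w])) \<le> 2 * M - 1"
      using le zv(2) zw(2) by linarith
    moreover have "F \<inter> set ys \<subseteq> set (cs @ [w])"
      using s1 s2 by auto
    then have "card (F \<inter> set ys) \<le> length (cs @ [w])"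
      by (meson List.finite_set card_length card_mono order_trans)
    ultimately show ?thesis by linarith
  qed
  then show ?thesis using ys by (auto simp: Q_def)
qed


lemma exists_separator_of_fractional_hitting:
  assumes "A \<subseteq> V" "V \<noteq> {}"
    and y: "\<And>F. F \<in> \<F> \<Longrightarrow> 0 \<le> y F"
    and heavy: "\<And>a b xs. a \<in> A \<Longrightarrow> b \<in> B \<Longrightarrow> walk E a xs b \<Longrightarrow>
      1 \<le> (\<Sum>F | F \<in> \<F> \<and> F \<inter> set xs \<noteq> {}. y F)"
  shows "\<exists>S\<subseteq>V. (\<forall>a\<in>A. \<forall>b\<in>B. \<forall>xs. walk E a xs b \<longrightarrow> set xs \<inter> S \<noteq> {}) \<and>
    fcov \<F> S \<le> 6 * M * arsinh (card V / M) * (\<Sum>F\<in>\<F>. y F)"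
proof -
  define n where "n = real (card V)"
  have n: "0 < n" using assms(2) finite_V by (auto simp: n_def card_gt_0_iff)
  have M: "0 < M" using M_ge_1 by simp
  define x where "x v = (\<Sum>F | F \<in> \<F> \<and> v \<in> F. y F)" for v
  have x0: "0 \<le> x v" for v unfolding x_def by (rule sum_nonneg) (use y in auto)
  \<comment> \<open>Discarding the small lengths costs a walk at most \<open>n \<cdot> 1 / (2n) = 1 / 2\<close>.\<close>
  define x' where "x' v = (if 1 / (2 * n) < x v then x v else 0)" for v
  have x'0: "0 \<le> x' v" and x'x: "x' v \<le> x v" and xx': "x v \<le> x' v + 1 / (2 * n)" for v
    using x0[of v] n by (auto simp: x'_def)
  have long: "1 / 2 \<le> (\<Sum>v\<leftarrow>xs. x' v)" if ab: "a \<in> A" "b \<in> B" and w: "walk E a xs b" for a b xs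
  proof -
    have sub: "set xs \<subseteq> V" using walk_set_subset[OF w] ab assms(1) E_in_V by blast
    have "1 \<le> (\<Sum>F | F \<in> \<F> \<and> F \<inter> set xs \<noteq> {}. y F)" using heavy ab w by blast
    also have "\<dots> = (\<Sum>F\<in>\<F>. if F \<inter> set xs \<noteq> {} then y F else 0)"
      by (simp add: finite_\<F> sum.inter_filter)
    \<comment> \<open>Each member that is hit is charged to its vertices on the walk; swapping the
      sums turns hitting weight into length.\<close>
    also have "\<dots> \<le> (\<Sum>F\<in>\<F>. \<Sum>v | v \<in> set xs \<and> v \<in> F. y F)"
    proof (rule sum_mono)
      fix F assume F: "F \<in> \<F>"
      have "1 \<le> card {v \<in> set xs. v \<in> F}" if "F \<inter> set xs \<noteq> {}"
        using that by (auto simp: Suc_le_eq card_gt_0_iff)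
      then show "(if F \<inter> set xs \<noteq> {} then y F else 0) \<le> (\<Sum>v | v \<in> set xs \<and> v \<in> F. y F)"
        using y[OF F] mult_right_mono[of 1 "real (card {v \<in> set xs. v \<in> F})" "y F"] by auto
    qed
    also have "\<dots> = (\<Sum>v\<in>set xs. x v)"
      unfolding x_def using finite_\<F> by (subst sum.swap_restrict) auto
    also have "\<dots> \<le> (\<Sum>v\<in>set xs. x' v + 1 / (2 * n))" by (intro sum_mono xx')
    also have "\<dots> = (\<Sum>v\<in>set xs. x' v) + card (set xs) / (2 * n)" by (simp add: sum.distrib)
    also have "card (set xs) / (2 * n) \<le> 1 / 2"
      using card_mono[OF finite_V sub] n by (simp add: n_def field_simps)
    also have "(\<Sum>v\<in>set xs. x' v) \<le> (\<Sum>v\<leftarrow>xs. x' v)"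
      using x'0 by (rule sum_set_le_sum_list)
    finally show ?thesis by simp
  qed
  obtain p where p0: "\<And>v. 0 \<le> p v" and pR: "\<And>v. p v \<le> 1 / 2"
    and pE: "\<And>u v. E u v \<Longrightarrow> p v \<le> p u + x' v"
    and pA: "\<And>a. a \<in> A \<Longrightarrow> p a \<le> x' a" and pB: "\<And>b. b \<in> B \<Longrightarrow> 1 / 2 \<le> p b"
    using truncated_distance_exists[of x' "1/2" A B E] x'0 long by (metis half_gt_zero_iff less_imp_le zero_less_one)
  \<comment> \<open>Chosen so that \<open>a \<le> M * x v\<close> whenever the length of
    \<open>v\<close> was not discarded; smoothing at this scale costs only a constant
    factor.\<close>
  define a where "a = M / (2 * n)"
  have a: "0 < a" using M n by (simp add: a_def)
  obtain r where r: "0 < r" "r < 1 / 2"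
    and avg: "(\<Sum>F\<in>\<F>. y F / sqrt ((r - p (root F))\<^sup>2 + a\<^sup>2)) \<le> 4 * arsinh (1 / (2 * a)) * (\<Sum>F\<in>\<F>. y F)"
    using exists_small_kernel_sum[OF finite_\<F>, of y "\<lambda>F. p (root F)" a] y p0 pR a by blast
  \<comment> \<open>A vertex of discarded length has \<open>x' v = 0\<close> and cannot satisfy both
    inequalities, so only lengths above \<open>1 / (2 * n)\<close> occur in
    \<open>S\<close>.\<close>
  define S where "S = {v \<in> V. p v - x' v < r \<and> r \<le> p v}"
  \<comment> \<open>On \<open>S\<close> both squares under the root are at most that of
    \<open>M * x v\<close>, and the square root of 2 is below 3/2. Hence
    \<open>z F \<ge> y F / x v\<close>, and these quotients sum to 1 over the members containing
    \<open>v\<close>.\<close>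
  define z where "z F = 3 / 2 * M * (y F / sqrt ((r - p (root F))\<^sup>2 + a\<^sup>2))" for F
  have z0: "0 \<le> z F" if "F \<in> \<F>" for F using y[OF that] M by (simp add: z_def)
  have cover: "1 \<le> (\<Sum>F | F \<in> \<F> \<and> v \<in> F. z F)" if v: "v \<in> S" for v
  proof -
    have pv: "p v - x' v < r" "r \<le> p v" using v by (auto simp: S_def)
    then have big: "1 / (2 * n) < x v" and x'v: "x' v = x v"
      by (auto simp: x'_def split: if_splits)
    have xv: "0 < x v" using big n by (meson divide_pos_pos less_trans mult_pos_pos zero_less_numeral zero_less_one)
    have "y F / x v \<le> z F" if F: "F \<in> \<F>" "v \<in> F" for F
    proof -
      obtain zs where zs: "walk E (root F) zs v" "real (length zs) \<le> M"
        "\<forall>F'\<in>\<F>. F' \<inter> set zs \<noteq> {} \<longrightarrow> v \<in> F'"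
        using root_walk[OF F] by blast
      \<comment> \<open>Every member containing \<open>u\<close> meets \<open>zs\<close> and
        therefore contains \<open>v\<close>.\<close>
      have "x u \<le> x v" if "u \<in> set zs" for u
        unfolding x_def using zs(3) that y finite_\<F> by (intro sum_mono2) auto
      then have le: "x' u \<le> x v" if "u \<in> set zs" for u using x'x[of u] that by fastforce
      have "\<bar>p (root F) - p v\<bar> \<le> (real (length zs) - 1) * x v"
      proof (rule walk_lipschitz[OF zs(1)])
        fix u w assume "E u w" "u \<in> set zs" "w \<in> set zs"
        then show "\<bar>p u - p w\<bar> \<le> x v"
          using pE[of u w] pE[of w u] E_sym le[of u] le[of w] by fastforce
      qed
      also have "\<dots> \<le> (M - 1) * x v" using zs(2) xv by (intro mult_right_mono) auto
      \<comment> \<open>The walk contributes \<open>M - 1\<close> times \<open>x v\<close>; the gap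
        between \<open>p v\<close> and \<open>r\<close> contributes one more
        \<open>x v\<close>.\<close>
      finally have "\<bar>r - p (root F)\<bar> \<le> M * x v" using pv x'v by (simp add: algebra_simps)
      then have "(r - p (root F))\<^sup>2 \<le> (M * x v)\<^sup>2"
        by (metis abs_ge_zero power2_abs power_mono)
      moreover have "a \<le> M * x v"
        using mult_left_mono[OF less_imp_le[OF big], of M] M by (simp add: a_def)
      then have "a\<^sup>2 \<le> (M * x v)\<^sup>2" using a by (intro power_mono) auto
      moreover have "(3 / 2 * (M * x v))\<^sup>2 = 9 / 4 * (M * x v)\<^sup>2"
        by (simp add: power2_eq_square)
      ultimately have "(r - p (root F))\<^sup>2 + a\<^sup>2 \<le> (3 / 2 * (M * x v))\<^sup>2"
        using zero_le_power2[of "M * x v"] by linarith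
      then have "sqrt ((r - p (root F))\<^sup>2 + a\<^sup>2) \<le> 3 / 2 * (M * x v)"
        using M xv by (intro real_le_lsqrt) auto
      moreover have "0 < sqrt ((r - p (root F))\<^sup>2 + a\<^sup>2)"
        using a by (simp add: add_nonneg_pos)
      ultimately have "1 / (3 / 2 * (M * x v)) \<le> 1 / sqrt ((r - p (root F))\<^sup>2 + a\<^sup>2)"
        by (intro divide_left_mono) (use M xv in auto)
      then have "(3 / 2 * M * y F) * (1 / (3 / 2 * (M * x v))) \<le> (3 / 2 * M * y F) * (1 / sqrt ((r - p (root F))\<^sup>2 + a\<^sup>2))"
        using M y[OF F(1)] by (intro mult_left_mono) auto
      then show ?thesis using M by (simp add: z_def)
    qed
    then have "(\<Sum>F | F \<in> \<F> \<and> v \<in> F. y F / x v) \<le> (\<Sum>F | F \<in> \<F> \<and> v \<in> F. z F)"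
      by (intro sum_mono) auto
    moreover have "(\<Sum>F | F \<in> \<F> \<and> v \<in> F. y F / x v) = 1"
      using xv by (simp add: sum_divide_distrib[symmetric] x_def[symmetric])
    ultimately show ?thesis by simp
  qed
  have "fcov \<F> S \<le> (\<Sum>F\<in>\<F>. z F)"
    unfolding fcov_def
  proof (rule cInf_lower)
    show "bdd_below {\<Sum>F\<in>\<F>. y F :: real |y. (\<forall>F\<in>\<F>. 0 \<le> y F) \<and>
        (\<forall>v\<in>S. 1 \<le> (\<Sum>F | F \<in> \<F> \<and> v \<in> F. y F))}"
      by (rule bdd_belowI[of _ 0]) (auto intro!: sum_nonneg)
  qed (use z0 cover in blast)
  also have "\<dots> = 3 / 2 * M * (\<Sum>F\<in>\<F>. y F / sqrt ((r - p (root F))\<^sup>2 + a\<^sup>2))"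
    by (simp add: z_def sum_distrib_left)
  also have "\<dots> \<le> 3 / 2 * M * (4 * arsinh (1 / (2 * a)) * (\<Sum>F\<in>\<F>. y F))"
    using avg M by (intro mult_left_mono) auto
  also have "\<dots> = 6 * M * arsinh (card V / M) * (\<Sum>F\<in>\<F>. y F)"
    by (simp add: a_def n_def)
  finally have "fcov \<F> S \<le> 6 * M * arsinh (card V / M) * (\<Sum>F\<in>\<F>. y F)" .
  moreover have "set xs \<inter> S \<noteq> {}" if ab: "a \<in> A" "b \<in> B" and w: "walk E a xs b" for a b xs
  proof -
    have "set xs \<subseteq> V" using walk_set_subset[OF w] ab assms(1) E_in_V by blast
    moreover have "\<exists>v\<in>set xs. p v - x' v < r \<and> r \<le> p v"
      using walk_crosses_threshold[OF w pE] pA[OF ab(1)] pB[OF ab(2)] r by simp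
    ultimately show ?thesis by (auto simp: S_def)
  qed
  moreover have "S \<subseteq> V" by (auto simp: S_def)
  ultimately show ?thesis by blast
qed

end

section \<open>Greedy selection\<close>

text \<open>Apply \<open>light\<close> to the current weights, 2 to the number of hits. The chosen
  \<open>P\<close> doubles only members carrying at most a \<open>1 / f\<close> fraction of the
  total.\<close>

lemma exists_evenly_hitting_list:
  fixes f :: real
  assumes "finite I" "0 < f"
    and light: "\<And>y :: 'i \<Rightarrow> real. (\<And>i. i \<in> I \<Longrightarrow> 0 \<le> y i) \<Longrightarrow>
      \<exists>P\<in>\<P>. f * (\<Sum>i | i \<in> I \<and> hits P i. y i) \<le> (\<Sum>i\<in>I. y i)"
  shows "\<exists>Ps. length Ps = N \<and> set Ps \<subseteq> \<P> \<and>
    (\<Sum>i\<in>I. 2 ^ length (filter (\<lambda>P. hits P i) Ps)) \<le> card I * (1 + 1 / f) ^ N"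
proof (induction N)
  case (Suc N)
  then obtain Ps where Ps: "length Ps = N" "set Ps \<subseteq> \<P>"
    and IH: "(\<Sum>i\<in>I. 2 ^ length (filter (\<lambda>P. hits P i) Ps)) \<le> card I * (1 + 1 / f) ^ N"
    by blast
  define y :: "'i \<Rightarrow> real" where "y i = 2 ^ length (filter (\<lambda>P. hits P i) Ps)" for i
  obtain P where P: "P \<in> \<P>" "f * (\<Sum>i | i \<in> I \<and> hits P i. y i) \<le> (\<Sum>i\<in>I. y i)"
    using light[of y] by (auto simp: y_def)
  have "(\<Sum>i\<in>I. 2 ^ length (filter (\<lambda>P. hits P i) (P # Ps))) =
      (\<Sum>i\<in>I. y i + (if hits P i then y i else 0))"
    by (intro sum.cong) (auto simp: y_def)
  also have "\<dots> = (\<Sum>i\<in>I. y i) + (\<Sum>i | i \<in> I \<and> hits P i. y i)"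
    using assms(1) by (simp add: sum.distrib sum.inter_filter)
  also have "\<dots> \<le> (1 + 1 / f) * (\<Sum>i\<in>I. y i)"
    using P(2) assms(2) by (simp add: field_simps)
  also have "\<dots> \<le> (1 + 1 / f) * (card I * (1 + 1 / f) ^ N)"
    using IH assms(2) by (intro mult_left_mono) (auto simp: y_def)
  finally show ?case
    using Ps P(1) by (intro exI[of _ "P # Ps"]) (simp add: mult_ac)
qed auto

lemma length_le_sum_hits:
  assumes "finite C" "\<And>P. P \<in> set Ps \<Longrightarrow> \<exists>i\<in>C. hits P i"
  shows "length Ps \<le> (\<Sum>i\<in>C. length (filter (\<lambda>P. hits P i) Ps))"
  using assms(2)
proof (induction Ps)
  case (Cons P Ps)
  have "(\<Sum>i\<in>C. length (filter (\<lambda>P. hits P i) (P # Ps))) =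
      (\<Sum>i\<in>C. length (filter (\<lambda>P. hits P i) Ps) + (if hits P i then 1 else 0))"
    by (intro sum.cong) auto
  also have "\<dots> = (\<Sum>i\<in>C. length (filter (\<lambda>P. hits P i) Ps)) + card {i \<in> C. hits P i}"
    using assms(1) by (simp add: sum.distrib sum.inter_filter[symmetric])
  moreover have "1 \<le> card {i \<in> C. hits P i}"
    using Cons.prems[of P] assms(1) by (auto simp: Suc_le_eq card_gt_0_iff)
  ultimately show ?case using Cons by simp
qed simp

lemma card_Union_set_le_hits:
  fixes k :: real
  assumes "\<And>xs. xs \<in> set Ps \<Longrightarrow> card (F \<inter> set xs) \<le> k"
  shows "card (F \<inter> (\<Union>xs\<in>set Ps. set xs)) \<le> length (filter (\<lambda>xs. F \<inter> set xs \<noteq> {}) Ps) * k"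
  using assms
proof (induction Ps)
  case (Cons P Ps)
  let ?U = "\<Union>xs\<in>set Ps. set xs"
  have IH: "card (F \<inter> ?U) \<le> length (filter (\<lambda>xs. F \<inter> set xs \<noteq> {}) Ps) * k"
    using Cons by simp
  have "F \<inter> (\<Union>xs\<in>set (P # Ps). set xs) = (F \<inter> set P) \<union> (F \<inter> ?U)" by auto
  then have "card (F \<inter> (\<Union>xs\<in>set (P # Ps). set xs)) \<le> card (F \<inter> set P) + card (F \<inter> ?U)"
    by (metis card_Un_le)
  moreover have "real (card (F \<inter> set P)) \<le> k" using Cons.prems by simp
  ultimately show ?case using IH by (auto simp: algebra_simps)
qed simp

section \<open>Layered families\<close>

lemma (in wf_digraph) apath_imp_walk:
  assumes "apath a p b"
  shows "walk (\<lambda>u v. u \<rightarrow> v) a (awalk_verts a p) b"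
proof -
  have "awalk a p b" using assms by (rule awalkI_apath)
  then show ?thesis
  proof (induction p arbitrary: a)
    case (Cons e p)
    then have e: "e \<in> arcs G" "tail G e = a" "awalk (head G e) p b" by (auto simp: awalk_Cons_iff)
    have "hd (awalk_verts (head G e) p) = head G e" by (cases p) (use e(3) in \<open>auto simp: awalk_Cons_iff\<close>)
    then show ?case using Cons.IH[OF e(3)] e in_arcs_imp_in_arcs_ends[OF e(1)]
      by (simp add: walk_Cons)
  qed (auto simp: awalk_Nil_iff)
qed

text \<open>\<open>separator\<close> speaks of simple paths only. Removing cycles adds no vertices,
  so a separator meets every walk as well.\<close>

lemma (in wf_digraph) walk_imp_apath:
  assumes "walk (\<lambda>u v. u \<rightarrow> v) a xs b" "a \<in> verts G"
  shows "\<exists>p. apath a p b \<and> set (awalk_verts a p) \<subseteq> set xs"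
proof -
  have "\<exists>p. awalk a p b \<and> awalk_verts a p = xs"
    using assms
  proof (induction xs arbitrary: a)
    case (Cons x xs)
    show ?case
    proof (cases "xs = []")
      case True
      then show ?thesis using Cons.prems by (intro exI[of _ "[]"]) (auto simp: walk_Cons awalk_Nil_iff)
    next
      case False
      then have e: "a = x" "a \<rightarrow> hd xs" "walk (\<lambda>u v. u \<rightarrow> v) (hd xs) xs b"
        using Cons.prems by (auto simp: walk_Cons)
      then obtain p where p: "awalk (hd xs) p b" "awalk_verts (hd xs) p = xs"
        using Cons.IH adj_in_verts(2) by blast
      obtain c where c: "c \<in> arcs G" "tail G c = a" "head G c = hd xs"
        using e(2) by (auto simp: arcs_ends_conv)
      then show ?thesis using p e(1)
        by (intro exI[of _ "c # p"]) (auto simp: awalk_Cons_iff)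
    qed
  qed simp
  then obtain p where p: "awalk a p b" "awalk_verts a p = xs" by blast
  have ap: "apath a (awalk_to_apath p) b" using p(1) by (rule apath_awalk_to_apath)
  have "set (awalk_verts a (awalk_to_apath p)) \<subseteq> set (awalk_verts a p)"
    using awalk_to_apath_subset[OF p(1)] set_awalk_verts[OF p(1)]
      set_awalk_verts[OF awalkI_apath[OF ap]] by auto
  then show ?thesis using ap p(2) by blast
qed

lemma card_le_thickness:
  assumes "F \<in> \<F>"
  shows "card {L \<in> set Ls. F \<inter> L \<noteq> {}} \<le> thickness Ls \<F>"
proof -
  have "\<forall>F\<in>\<F>. card {L \<in> set Ls. F \<inter> L \<noteq> {}} \<le> card (set Ls)"
    by (auto intro!: card_mono)
  then have "\<forall>F\<in>\<F>. card {L \<in> set Ls. F \<inter> L \<noteq> {}} \<le> thickness Ls \<F>"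
    unfolding thickness_def by (rule LeastI)
  then show ?thesis using assms by blast
qed

text \<open>Along a walk in the layer digraph the layer index strictly drops, so its vertices lie in
  distinct parts, all meeting \<open>F\<close>. Members are closed under descendants, so one that
  meets the walk contains its end.\<close>

lemma layered_family_root_walk:
  assumes "graph G" and lf: "layered_family G Ls \<F>" and F: "F \<in> \<F>"
  shows "\<exists>c\<in>F. \<forall>v\<in>F. \<exists>zs. walk (\<lambda>u v. u \<rightarrow>\<^bsub>G\<^esub> v) c zs v \<and> length zs \<le> thickness Ls \<F> \<and>
    (\<forall>F'\<in>\<F>. F' \<inter> set zs \<noteq> {} \<longrightarrow> v \<in> F')"
proof -
  interpret graph G by fact
  let ?D = "layer_digraph G Ls"
  interpret D: wf_digraph ?D
    by unfold_locales (auto simp: layer_digraph_def)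
  have vD: "verts ?D = verts G" by (simp add: layer_digraph_def)
  have un: "\<Union>(set Ls) = verts G" and dj: "disjoint (set Ls)" and di: "distinct Ls"
    using lf by (auto simp: layered_family_def ordered_partition_def partition_on_def)
  have uniq: "i = j" if "i < length Ls" "j < length Ls" "x \<in> Ls ! i" "x \<in> Ls ! j" for i j x
    using dj di that by (metis disjoint_iff disjointD nth_eq_iff_index_eq nth_mem)
  have "\<exists>i<length Ls. v \<in> Ls ! i" if "v \<in> verts G" for v
    using that un by (metis UnionE in_set_conv_nth)
  then obtain idx where idx: "\<And>v. v \<in> verts G \<Longrightarrow> idx v < length Ls \<and> v \<in> Ls ! idx v"
    by metis
  have D_G: "u \<rightarrow>\<^bsub>G\<^esub> v" and dec: "idx v < idx u" if adj: "u \<rightarrow>\<^bsub>?D\<^esub> v" for u v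
  proof -
    obtain e where e: "e \<in> arcs ?D" "tail G e = u" "head G e = v"
      using adj by (auto simp: arcs_ends_conv layer_digraph_def)
    then have eG: "e \<in> arcs G" by (auto simp: layer_digraph_def)
    then show "u \<rightarrow>\<^bsub>G\<^esub> v" using e by (auto simp: arcs_ends_conv)
    obtain i j where "j < i" "i < length Ls" "u \<in> Ls ! i" "v \<in> Ls ! j"
      using e by (auto simp: layer_digraph_def)
    moreover have "u \<in> verts G" "v \<in> verts G" using e eG by auto
    ultimately show "idx v < idx u" using uniq idx by (metis order.strict_trans)
  qed
  obtain c where c: "c \<in> verts G" "F = descendants G Ls c"
    using lf F by (auto simp: layered_family_def)
  have "c \<in> F" using c vD by (simp add: descendants_def)
  moreover have "\<exists>zs. walk (\<lambda>u v. u \<rightarrow>\<^bsub>G\<^esub> v) c zs v \<and> length zs \<le> thickness Ls \<F> \<and>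
    (\<forall>F'\<in>\<F>. F' \<inter> set zs \<noteq> {} \<longrightarrow> v \<in> F')" if v: "v \<in> F" for v
  proof -
    have "c \<rightarrow>\<^sup>*\<^bsub>?D\<^esub> v" using v c by (simp add: descendants_def)
    \<comment> \<open>Reachability from \<open>c\<close> puts \<open>z\<close> into \<open>F\<close>
      for counting parts; reachability of \<open>v\<close> from \<open>z\<close> carries membership
      to the end.\<close>
    then have "\<exists>zs. walk (\<lambda>u v. u \<rightarrow>\<^bsub>?D\<^esub> v) c zs v \<and>
        (\<forall>z\<in>set zs. c \<rightarrow>\<^sup>*\<^bsub>?D\<^esub> z \<and> z \<rightarrow>\<^sup>*\<^bsub>?D\<^esub> v)"
    proof (induction rule: D.reachable_induct)
      case base
      then show ?case using c vD by (intro exI[of _ "[c]"]) auto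
    next
      case (step x y)
      then obtain zs where zs: "walk (\<lambda>u v. u \<rightarrow>\<^bsub>?D\<^esub> v) c zs x"
        "\<forall>z\<in>set zs. c \<rightarrow>\<^sup>*\<^bsub>?D\<^esub> z \<and> z \<rightarrow>\<^sup>*\<^bsub>?D\<^esub> x" by blast
      have "c \<rightarrow>\<^sup>*\<^bsub>?D\<^esub> y" "y \<rightarrow>\<^sup>*\<^bsub>?D\<^esub> y"
        using step by (auto intro: D.reachable_adj_trans D.adj_in_verts)
      then show ?case
        using walk_snoc[OF zs(1), of y] step(2) zs(2)
        by (intro exI[of _ "zs @ [y]"]) (auto intro: D.reachable_adj_trans)
    qed
    then obtain zs where zs: "walk (\<lambda>u v. u \<rightarrow>\<^bsub>?D\<^esub> v) c zs v"
      and cz: "\<And>z. z \<in> set zs \<Longrightarrow> c \<rightarrow>\<^sup>*\<^bsub>?D\<^esub> z" and zv: "\<And>z. z \<in> set zs \<Longrightarrow> z \<rightarrow>\<^sup>*\<^bsub>?D\<^esub> v"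
      by blast
    have zG: "z \<in> verts G" if "z \<in> set zs" for z
      using D.reachable_in_verts(2)[OF cz[OF that]] vD by simp
    have "successively (\<lambda>u v. idx u > idx v) zs"
      using zs dec by (auto simp: walk_def intro: successively_mono)
    then have sorted: "sorted_wrt (\<lambda>u v. idx u > idx v) zs"
      by (subst successively_conv_sorted_wrt[symmetric]) (auto intro: transpI)
    have "distinct (map idx zs)"
      using sorted by (induction zs) auto
    then have "distinct (map (\<lambda>z. Ls ! idx z) zs)"
      using di idx zG by (auto simp: distinct_map inj_on_def nth_eq_iff_index_eq)
    then have "length zs = card ((\<lambda>z. Ls ! idx z) ` set zs)"
      by (metis distinct_card length_map list.set_map)
    also have "\<dots> \<le> card {L \<in> set Ls. F \<inter> L \<noteq> {}}"
    proof (rule card_mono)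
      show "(\<lambda>z. Ls ! idx z) ` set zs \<subseteq> {L \<in> set Ls. F \<inter> L \<noteq> {}}"
        using idx zG cz c(2) by (fastforce simp: descendants_def)
    qed simp
    also have "\<dots> \<le> thickness Ls \<F>" using F by (rule card_le_thickness)
    finally have "length zs \<le> thickness Ls \<F>" .
    moreover have "v \<in> F'" if F': "F' \<in> \<F>" "F' \<inter> set zs \<noteq> {}" for F'
    proof -
      obtain z where "z \<in> F'" "z \<in> set zs" using F' by blast
      then show ?thesis using F'(1) lf zv[of z]
        by (auto simp: layered_family_def descendants_def intro: D.reachable_trans)
    qed
    moreover have "walk (\<lambda>u v. u \<rightarrow>\<^bsub>G\<^esub> v) c zs v" using zs by (rule walk_mono) (use D_G in auto)
    ultimately show ?thesis by blast
  qed
  ultimately show ?thesis by blast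
qed

text \<open>Each neighbour of \<open>v\<close> in \<open>U\<close> lies in
  \<open>F \<inter> U\<close> or in the part of the closed neighbourhood outside \<open>F\<close>.
  Degrees count arcs, hence the appeal to \<open>no_multi_arcs\<close>.\<close>

lemma (in graph) out_degree_induce_le:
  assumes "neighborhood_witnessing G k \<F>" "F \<in> \<F>" "v \<in> F" "v \<in> U" "U \<subseteq> verts G"
  shows "out_degree (G \<restriction> U) v \<le> card (F \<inter> U) + k"
proof -
  let ?O = "out_arcs (G \<restriction> U) v"
  have fin: "finite U" using assms(5) finite_verts finite_subset by blast
  have O: "?O \<subseteq> {e \<in> arcs G. tail G e = v \<and> head G e \<in> U}" by (auto simp: out_arcs_def)
  have "inj_on (head G) ?O"
    using O by (intro inj_onI no_multi_arcs) (auto simp: arc_to_ends_def)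
  then have "out_degree (G \<restriction> U) v = card (head G ` ?O)"
    by (simp add: out_degree_def card_image)
  also have sub: "head G ` ?O \<subseteq> (F \<inter> U) \<union> (closed_nbhd G v - F)"
    using O by (auto simp: closed_nbhd_def arcs_ends_conv)
  have "closed_nbhd G v \<subseteq> verts G"
    using assms by (auto simp: closed_nbhd_def)
  then have "finite (closed_nbhd G v)" using finite_verts finite_subset by blast
  then have "card (head G ` ?O) \<le> card ((F \<inter> U) \<union> (closed_nbhd G v - F))"
    using fin sub by (intro card_mono) auto
  also have "\<dots> \<le> card (F \<inter> U) + card (closed_nbhd G v - F)" by (rule card_Un_le)
  also have "\<dots> \<le> card (F \<inter> U) + k"
    using assms by (auto simp: neighborhood_witnessing_def)
  finally show ?thesis .
qed

lemma (in digraph) out_degree_bound_imp_max_degree_le: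
  assumes "\<And>v. v \<in> verts G \<Longrightarrow> real (out_degree G v) \<le> k" "0 \<le> k"
  shows "real (max_degree G) \<le> k"
proof -
  have "max_degree G \<in> insert 0 (out_degree G ` verts G)"
    unfolding max_degree_def by (rule Max_in) auto
  then show ?thesis using assms by auto
qed

section \<open>Covers and numerical estimates\<close>

lemma cov_witness:
  assumes "finite \<F>" "S \<subseteq> \<Union>\<F>"
  obtains \<C> where "\<C> \<subseteq> \<F>" "finite \<C>" "S \<subseteq> \<Union>\<C>" "card \<C> = cov \<F> S"
proof -
  have "\<exists>\<C>\<subseteq>\<F>. finite \<C> \<and> S \<subseteq> \<Union>\<C> \<and> card \<C> = cov \<F> S"
    unfolding cov_def by (rule LeastI[of _ "card \<F>"]) (use assms in blast)
  then show thesis using that by blast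
qed

text \<open>Excludes the null graph in the theorem, where \<open>d > 0\<close>.\<close>

lemma degeneracy_null_graph:
  assumes "verts G = {}"
  shows "degeneracy G = 0"
  using assms by (auto simp: degeneracy_def subgraph_def intro!: Least_equality)

text \<open>The logarithm is at least 2, so the argument \<open>t\<close> is at most
  \<open>n / 2\<close>, and
  \<open>t + sqrt (t\<^sup>2 + 1) \<le> 2 * t + 1 \<le> 2 * n\<close>.\<close>

lemma arsinh_le_log:
  assumes "2 \<le> n"
  shows "arsinh (n / log 2 (2 * n)) \<le> log 2 (2 * n)"
proof -
  let ?q = "log 2 (2 * n)"
  have "log 2 4 \<le> ?q" using assms by simp
  moreover have "log 2 4 = 2" using log_pow_cancel[of 2 2] by simp
  ultimately have q: "2 \<le> ?q" by simp
  define t where "t = n / ?q"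
  have t: "0 \<le> t" "t \<le> n / 2" using q assms by (auto simp: t_def field_simps)
  have "sqrt (t\<^sup>2 + 1) \<le> t + 1"
    using t by (intro real_le_lsqrt) (auto simp: power2_eq_square algebra_simps)
  then have "t + sqrt (t\<^sup>2 + 1) \<le> 2 * n" using t assms by linarith
  then have "arsinh t \<le> ln (2 * n)"
    unfolding arsinh_real_def using arsinh_real_aux[of t] by (intro ln_mono) auto
  also have "\<dots> = ln 2 * ?q" by (simp add: log_def)
  also have "\<dots> \<le> 1 * ?q" using q ln_2_less_1 by (intro mult_right_mono) auto
  finally show ?thesis by (simp add: t_def)
qed

text \<open>Here \<open>n\<close> is 2 to the power \<open>q - 1\<close>, and the growth factor is
  at most \<open>exp (N / f)\<close>, which is at most 4 to the power \<open>q + 1\<close>. The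
  exponents add up to \<open>3 * q + 1\<close>.\<close>

lemma hit_count_bound:
  fixes n f q :: real and X N :: nat
  assumes "q = log 2 (2 * n)" "2 \<le> n" "1 \<le> f" "real N \<le> f * q + 1"
    and X: "2 ^ X \<le> n * (1 + 1 / f) ^ N"
  shows "real X \<le> 6 * q"
proof -
  have n: "n = 2 powr (q - 1)" using assms by (simp add: powr_diff)
  have "log 2 4 \<le> q" using assms by simp
  moreover have "log 2 4 = (2::real)" using log_pow_cancel[of 2 2] by simp
  ultimately have q: "2 \<le> q" by simp
  have "real N / f \<le> (f * q + 1) / f" using assms by (intro divide_right_mono) auto
  also have "\<dots> = q + 1 / f" using assms(3) by (simp add: field_simps)
  also have "\<dots> \<le> q + 1" using assms(3) by simp
  finally have Nf: "real N / f \<le> q + 1" .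
  have "(1 + 1 / f) ^ N \<le> exp (1 / f) ^ N"
    using assms(3) by (intro power_mono exp_ge_add_one_self) auto
  also have "\<dots> = exp (real N / f)" by (simp add: exp_of_nat_mult[symmetric])
  also have "\<dots> \<le> exp (q + 1)" using Nf by simp
  also have "\<dots> = exp 1 powr (q + 1)" by (simp add: powr_def)
  also have "\<dots> \<le> 4 powr (q + 1)" using q exp_le by (intro powr_mono2) auto
  also have "\<dots> = (2 powr 2) powr (q + 1)" by simp
  also have "\<dots> = 2 powr (2 * (q + 1))" by (simp only: powr_powr)
  finally have "n * (1 + 1 / f) ^ N \<le> 2 powr (q - 1) * 2 powr (2 * (q + 1))"
    unfolding n by (intro mult_left_mono) auto
  also have "\<dots> = 2 powr (3 * q + 1)" by (simp add: powr_add[symmetric] algebra_simps)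
  finally have "2 powr real X \<le> 2 powr (3 * q + 1)" using X by (simp add: powr_realpow)
  then have "real X \<le> 3 * q + 1" by simp
  then show ?thesis using q by simp
qed

section \<open>The dichotomy between a light separator and a sparse subgraph\<close>

theorem theorem8p7:
  fixes G :: "('a,'b) pre_digraph" and d f n :: nat
    and Ls :: "'a set list" and \<F> :: "'a set set" and A B :: "'a set"
  assumes "graph G" and "card (verts G) = n"
    and "d > 0" and "f > 0"
    and "degeneracy G = d"
    and "layered_family G Ls \<F>"
    and "neighborhood_witnessing G (4 * d) \<F>"
    and "int (thickness Ls \<F>) \<le> \<lceil>log 2 (real n)\<rceil>"
    and "A \<subseteq> verts G" and "B \<subseteq> verts G"
  shows "(\<exists>S. separator G A B S \<and> fcov \<F> S \<le> 8 * (log 2 (2 * real n))\<^sup>2 * real f) \<or>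
    (\<exists>H. induced_subgraph H G \<and>
       real (max_degree H) \<le> 12 * (log 2 (2 * real n))\<^sup>2 + 4 * real d \<and>
       (\<forall>S. separator H (A \<inter> verts H) (B \<inter> verts H) S \<longrightarrow> real (cov \<F> S) \<ge> real f / 6))"
proof -
  interpret graph G by fact
  let ?E = "\<lambda>u v. u \<rightarrow>\<^bsub>G\<^esub> v"
  have finF: "finite \<F>" and UnF: "\<Union>\<F> = verts G"
    using layered_family_finite layered_family_covers assms(1,6) by blast+
  have ne: "verts G \<noteq> {}" using degeneracy_null_graph assms(3,5) by force
  have cardF: "card \<F> \<le> n"
  proof -
    have "card \<F> \<le> card {u \<in> verts G. in_arcs (layer_digraph G Ls) u = {}}"
      using assms(6) by (simp add: layered_family_def card_image_le)
    also have "\<dots> \<le> n" unfolding assms(2)[symmetric] by (intro card_mono) auto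
    finally show ?thesis .
  qed
  have "\<exists>root. \<forall>F\<in>\<F>. root F \<in> F \<and> (\<forall>v\<in>F. \<exists>zs. walk ?E (root F) zs v \<and>
      length zs \<le> thickness Ls \<F> \<and> (\<forall>F'\<in>\<F>. F' \<inter> set zs \<noteq> {} \<longrightarrow> v \<in> F'))"
    by (intro bchoice ballI) (use layered_family_root_walk[OF assms(1,6)] in blast)
  then obtain root where root: "\<And>F. F \<in> \<F> \<Longrightarrow> root F \<in> F"
    and root_walk: "\<And>F v. F \<in> \<F> \<Longrightarrow> v \<in> F \<Longrightarrow> \<exists>zs. walk ?E (root F) zs v \<and>
      length zs \<le> thickness Ls \<F> \<and> (\<forall>F'\<in>\<F>. F' \<inter> set zs \<noteq> {} \<longrightarrow> v \<in> F')"
    by blast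
  define q where "q = log 2 (2 * real n)"
  have npos: "0 < n" using ne assms(2) by (auto simp: card_gt_0_iff)
  then have q_eq: "q = 1 + log 2 n" by (simp add: q_def log_mult)
  obtain F0 where F0: "F0 \<in> \<F>" using ne UnF by blast
  obtain zs where "walk ?E (root F0) zs (root F0)" "length zs \<le> thickness Ls \<F>"
    using root_walk[OF F0 root[OF F0]] by blast
  \<comment> \<open>A root lies in its own member, so the thickness is positive; as the logarithm of
    1 is 0, this excludes \<open>n = 1\<close>.\<close>
  then have "1 \<le> thickness Ls \<F>" by (cases zs) auto
  then have "0 < \<lceil>log 2 (real n)\<rceil>" using assms(8) by linarith
  then have "0 < log 2 (real n)" by simp
  then have n2: "2 \<le> n" using npos by (cases "n = 1") auto
  \<comment> \<open>Rounding up adds at most 1, which turns the logarithm of \<open>n\<close> into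
    that of \<open>2 * n\<close>.\<close>
  have th: "real (thickness Ls \<F>) \<le> q"
    using assms(8) q_eq by linarith
  have q1: "1 \<le> q" using \<open>0 < log 2 (real n)\<close> q_eq by simp
  interpret rooted_family "verts G" ?E \<F> root q
  proof
    show "\<And>u v. ?E u v \<Longrightarrow> ?E v u" using graph_symmetric by blast
    show "\<exists>zs. walk ?E (root F) zs v \<and> real (length zs) \<le> q \<and>
      (\<forall>F'\<in>\<F>. F' \<inter> set zs \<noteq> {} \<longrightarrow> v \<in> F')" if "F \<in> \<F>" "v \<in> F" for F v
      using root_walk[OF that] th by (meson of_nat_le_iff order_trans)
  qed (use finF UnF q1 in auto)
  show ?thesis
  proof (cases "\<exists>S. separator G A B S \<and> fcov \<F> S \<le> 8 * q\<^sup>2 * real f")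
    case True
    then show ?thesis by (auto simp: q_def)
  next
    case no_sep: False
    define \<P> where "\<P> = {xs. (\<exists>a\<in>A. \<exists>b\<in>B. walk ?E a xs b) \<and>
      (\<forall>F\<in>\<F>. real (card (F \<inter> set xs)) \<le> 2 * q - 1)}"
    have light: "\<exists>P\<in>\<P>. real f * (\<Sum>F | F \<in> \<F> \<and> F \<inter> set P \<noteq> {}. y F) \<le> (\<Sum>F\<in>\<F>. y F)"
      if y: "\<And>F. F \<in> \<F> \<Longrightarrow> 0 \<le> y F" for y :: "'a set \<Rightarrow> real"
    proof (rule ccontr)
      assume contr: "\<not> ?thesis"
      let ?Y = "\<Sum>F\<in>\<F>. y F"
      have Y0: "0 \<le> ?Y" using y by (rule sum_nonneg)
      \<comment> \<open>Weights rescaled to total \<open>f\<close> hit every walk in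
        \<open>\<P>\<close> with weight at least 1. An arbitrary walk inherits this from its short
        version, which meets no new members.\<close>
      have heavy: "1 \<le> (\<Sum>F | F \<in> \<F> \<and> F \<inter> set xs \<noteq> {}. f * y F / ?Y)"
        if ab: "a \<in> A" "b \<in> B" and w: "walk ?E a xs b" for a b xs
      proof -
        obtain ys where ys: "walk ?E a ys b" "\<forall>F\<in>\<F>. F \<inter> set ys \<noteq> {} \<longrightarrow> F \<inter> set xs \<noteq> {}"
          "\<forall>F\<in>\<F>. real (card (F \<inter> set ys)) \<le> 2 * q - 1"
          using exists_short_walk[OF w] by blast
        then have "ys \<in> \<P>" using ab by (auto simp: \<P>_def)
        then have "?Y < f * (\<Sum>F | F \<in> \<F> \<and> F \<inter> set ys \<noteq> {}. y F)"
          using contr by auto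
        also have "\<dots> \<le> f * (\<Sum>F | F \<in> \<F> \<and> F \<inter> set xs \<noteq> {}. y F)"
          using ys(2) y finF by (intro mult_left_mono sum_mono2) auto
        finally have lt: "?Y < f * (\<Sum>F | F \<in> \<F> \<and> F \<inter> set xs \<noteq> {}. y F)" .
        have "(\<Sum>F | F \<in> \<F> \<and> F \<inter> set xs \<noteq> {}. y F) \<le> ?Y"
          using y finF by (intro sum_mono2) auto
        \<comment> \<open>If \<open>?Y\<close> were 0, the hitting weight would be both positive and
          at most 0.\<close>
        then have "?Y \<noteq> 0" using lt by (auto simp: zero_less_mult_iff)
        then show ?thesis
          using lt Y0 by (simp add: sum_divide_distrib[symmetric] sum_distrib_left[symmetric])
      qed
      have "\<exists>S\<subseteq>verts G. (\<forall>a\<in>A. \<forall>b\<in>B. \<forall>xs. walk ?E a xs b \<longrightarrow> set xs \<inter> S \<noteq> {}) \<and>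
        fcov \<F> S \<le> 6 * q * arsinh (card (verts G) / q) * (\<Sum>F\<in>\<F>. f * y F / ?Y)"
        using assms(9) ne
      proof (rule exists_separator_of_fractional_hitting)
        show "0 \<le> f * y F / ?Y" if "F \<in> \<F>" for F using y[OF that] Y0 by simp
      qed (rule heavy)
      then obtain S where S: "S \<subseteq> verts G"
        "\<forall>a\<in>A. \<forall>b\<in>B. \<forall>xs. walk ?E a xs b \<longrightarrow> set xs \<inter> S \<noteq> {}"
        "fcov \<F> S \<le> 6 * q * arsinh (card (verts G) / q) * (\<Sum>F\<in>\<F>. f * y F / ?Y)"
        by blast
      note S(3)
      also have "6 * q * arsinh (card (verts G) / q) * (\<Sum>F\<in>\<F>. f * y F / ?Y) \<le> 8 * q\<^sup>2 * real f"
      proof (rule mult_mono)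
        have "arsinh (card (verts G) / q) \<le> q"
          using arsinh_le_log[of n] n2 assms(2) by (simp add: q_def)
        then have "6 * q * arsinh (card (verts G) / q) \<le> 6 * q * q"
          using q1 by (intro mult_left_mono) auto
        also have "\<dots> \<le> 8 * q\<^sup>2" using q1 by (simp add: power2_eq_square)
        finally show "6 * q * arsinh (card (verts G) / q) \<le> 8 * q\<^sup>2" .
        \<comment> \<open>\<open>?Y\<close> can be 0 when no walk joins \<open>A\<close> to
          \<open>B\<close>; division by zero then makes the sum 0.\<close>
        show "(\<Sum>F\<in>\<F>. f * y F / ?Y) \<le> f"
          by (simp add: sum_divide_distrib[symmetric] sum_distrib_left[symmetric])
        show "0 \<le> (\<Sum>F\<in>\<F>. f * y F / ?Y)"
          using y Y0 by (intro sum_nonneg) auto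
      qed simp
      finally have "fcov \<F> S \<le> 8 * q\<^sup>2 * f" .
      moreover have "separator G A B S"
        using S(1,2) apath_imp_walk by (auto simp: separator_def)
      ultimately show False using no_sep by blast
    qed
    define N where "N = nat \<lceil>real f * q\<rceil>"
    have N: "real f * q \<le> real N" "real N \<le> real f * q + 1"
      using q1 by (auto simp: N_def)
    obtain Ps where Ps: "length Ps = N" "set Ps \<subseteq> \<P>"
      and Phi: "(\<Sum>F\<in>\<F>. 2 ^ length (filter (\<lambda>xs. F \<inter> set xs \<noteq> {}) Ps)) \<le> card \<F> * (1 + 1 / real f) ^ N"
      using exists_evenly_hitting_list[OF finF, of "real f" \<P> "\<lambda>xs F. F \<inter> set xs \<noteq> {}" N] light assms(4)
      by auto
    define X where "X F = length (filter (\<lambda>xs. F \<inter> set xs \<noteq> {}) Ps)" for F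
    have X: "real (X F) \<le> 6 * q" if F: "F \<in> \<F>" for F
    proof (rule hit_count_bound)
      \<comment> \<open>The weight of one member is at most the total weight.\<close>
      have "2 ^ X F \<le> (\<Sum>F\<in>\<F>. 2 ^ X F :: real)"
        using F finF by (intro member_le_sum) auto
      also have "\<dots> \<le> card \<F> * (1 + 1 / real f) ^ N" using Phi by (simp add: X_def)
      also have "\<dots> \<le> real n * (1 + 1 / real f) ^ N"
        using cardF by (intro mult_right_mono) auto
      finally show "2 ^ X F \<le> real n * (1 + 1 / real f) ^ N" .
    qed (use q_def n2 assms(4) N(2) in auto)
    define U where "U = (\<Union>xs\<in>set Ps. set xs)"
    have short: "real (card (F \<inter> set xs)) \<le> 2 * q - 1" if "F \<in> \<F>" "xs \<in> set Ps" for F xs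
      using that Ps(2) by (auto simp: \<P>_def)
    have walks: "\<exists>a\<in>A. \<exists>b\<in>B. walk ?E a xs b" if "xs \<in> set Ps" for xs
      using that Ps(2) by (auto simp: \<P>_def)
    have UG: "U \<subseteq> verts G"
    proof -
      have "set xs \<subseteq> verts G" if xs: "xs \<in> set Ps" for xs
      proof -
        obtain a b where "a \<in> A" "walk ?E a xs b" using walks[OF xs] by blast
        then show ?thesis using walk_set_subset[of ?E a xs b "verts G"] assms(9) E_in_V by blast
      qed
      then show ?thesis by (auto simp: U_def)
    qed
    let ?H = "G \<restriction> U"
    have ind: "induced_subgraph ?H G" using UG by (rule induced_induce)
    interpret H: digraph ?H using ind by (rule digraph_subgraph[OF induced_imp_subgraph])
    have "real (max_degree ?H) \<le> 12 * q\<^sup>2 + 4 * real d"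
    proof (rule H.out_degree_bound_imp_max_degree_le)
      fix v assume v: "v \<in> verts ?H"
      then obtain F where F: "F \<in> \<F>" "v \<in> F" using UG UnF by auto
      have "real (card (F \<inter> U)) \<le> X F * (2 * q - 1)"
        unfolding U_def X_def by (rule card_Union_set_le_hits) (use short[OF F(1)] in blast)
      \<comment> \<open>At most \<open>6 * q\<close> of the walks meet \<open>F\<close>, each in at
        most \<open>2 * q - 1\<close> vertices.\<close>
      also have "\<dots> \<le> (6 * q) * (2 * q)"
        using X[OF F(1)] q1 by (intro mult_mono) auto
      finally have "real (card (F \<inter> U)) \<le> 12 * q\<^sup>2" by (simp add: power2_eq_square)
      moreover have "out_degree ?H v \<le> card (F \<inter> U) + 4 * d"
        using out_degree_induce_le[OF assms(7) F _ UG] v by simp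
      ultimately show "real (out_degree ?H v) \<le> 12 * q\<^sup>2 + 4 * real d" by linarith
    qed simp
    moreover have "real f / 6 \<le> cov \<F> S"
      if S: "separator ?H (A \<inter> verts ?H) (B \<inter> verts ?H) S" for S
    proof -
      have "S \<subseteq> \<Union>\<F>" using S UG UnF by (auto simp: separator_def)
      then obtain \<C> where C: "\<C> \<subseteq> \<F>" "finite \<C>" "S \<subseteq> \<Union>\<C>" "card \<C> = cov \<F> S"
        using cov_witness[OF finF] by blast
      have hit: "\<exists>F\<in>\<C>. F \<inter> set xs \<noteq> {}" if xs: "xs \<in> set Ps" for xs
      proof -
        obtain a b where ab: "a \<in> A" "b \<in> B" and w: "walk ?E a xs b" using walks[OF xs] by blast
        have xsU: "set xs \<subseteq> U" using xs by (auto simp: U_def)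
        have "walk (\<lambda>u v. u \<rightarrow>\<^bsub>?H\<^esub> v) a xs b"
          using w by (rule walk_mono) (use xsU in \<open>auto simp: arcs_ends_conv\<close>)
        moreover have abU: "a \<in> U" "b \<in> U"
          using w xsU by (auto simp: walk_def)
        ultimately obtain p where p: "H.apath a p b" "set (H.awalk_verts a p) \<subseteq> set xs"
          using H.walk_imp_apath[of a xs b] by auto
        then have "set (H.awalk_verts a p) \<inter> S \<noteq> {}"
          using S ab abU by (auto simp: separator_def)
        then show ?thesis using p(2) C(3) by blast
      qed
      \<comment> \<open>Each of the \<open>N\<close> walks meets a member of the cover, and each
        member meets at most \<open>6 * q\<close> walks; \<open>N \<ge> f * q\<close> then lets
        \<open>q\<close> cancel.\<close>
      have "N \<le> (\<Sum>F\<in>\<C>. X F)"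
        using length_le_sum_hits[OF C(2), of Ps "\<lambda>xs F. F \<inter> set xs \<noteq> {}"] hit Ps(1)
        by (simp add: X_def)
      then have "real N \<le> (\<Sum>F\<in>\<C>. real (X F))" by (metis of_nat_le_iff of_nat_sum)
      also have "\<dots> \<le> (\<Sum>F\<in>\<C>. 6 * q)" using X C(1) by (intro sum_mono) auto
      also have "\<dots> = 6 * cov \<F> S * q" using C(4) by simp
      finally have "real f * q \<le> 6 * cov \<F> S * q" using N(1) by linarith
      then have "real f \<le> 6 * cov \<F> S" using q1 by (simp add: mult_le_cancel_right)
      then show ?thesis by simp
    qed
    ultimately show ?thesis using ind unfolding q_def by blast
  qed
qed

end
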